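(* Let $G\colon\mathbb{R}^3\to\mathbb{R}$ be continuous and such that the system $\dot x(t)=G(p(t),x(t),u(t))$, $x(0)=x^0$, has non-unique control direction, i.e. both $\eta=-1$ and $\eta=+1$ are control directions (in the sense defined in the context). Let $\varphi\colon\mathbb{R}_{\ge 0}\to\mathbb{R}_{\ge 0}$ be a continuously differentiable bijection such that, for some $c_\varphi>0$, $\dot\varphi(t)\le c_\varphi(1+\varphi(t))$ for all $t\ge 0$. Let $$\mathcal{F}:=\{(t,\xi)\in\mathbb{R}_{\ge 0}\times\mathbb{R}\mid \varphi(t)|\xi|<1\},\qquad h\colon\mathcal{F}\to\mathbb{R},\quad h(t,\xi):=\frac{\varphi(t)\,\xi}{1-\varphi(t)|\xi|}.$$ Then the control objective is achieved by both the feedback $u(t)=-h(t,x(t))$ and its polarity-reversed counterpart $u(t)=h(t,x(t))$. That is, for each $\theta\in\{-1,+1\}$, for every $x^0\in\mathbb{R}$ and every bounded, continuous $p\colon\mathbb{R}_{\ge 0}\to\mathbb{R}$, the initial-value problem $$\dot x(t)=G\big(p(t),x(t),\theta h(t,x(t))\big),\qquad x(0)=x^0,$$ on the domain $\mathcal{F}$, has a solution; every solution has an extension to a solution on $\mathbb{R}_{\ge 0}$; and every global solution $x\colon\mathbb{R}_{\ge 0}\to\mathbb{R}$ satisfies $x(t)\to 0$ as $t\to\infty$, with the control input $t\mapsto\theta h(t,x(t))$ bounded on $\mathbb{R}_{\ge 0}$.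
   Context: Control direction: for continuous $G\colon\mathbb{R}^3\to\mathbb{R}$, a number $\eta\in\{-1,+1\}$ is a control direction for the system $\dot x(t)=G(p(t),x(t),u(t))$ if, for every nonempty compact $K\subset\mathbb{R}\times\mathbb{R}$, there exists $v^*\in(0,1)$ such that the function $$\chi\colon\mathbb{R}\to\mathbb{R},\quad s\mapsto\min\{vG(\rho,\xi,sv)\mid(\rho,\xi)\in K,\ v\in\mathbb{R},\ v^*\le|v|\le 1\}$$ has the property $\sup_{s\ge 0}\chi(\eta s)=+\infty$. Solution: a solution of the initial-value problem is a continuous function $x\colon I\to\mathbb{R}$ on a (nondegenerate) left-closed interval $I\subset\mathbb{R}_{\ge 0}$ with left endpoint $0$, with $x(0)=x^0$, with $\mathrm{graph}(x)=\{(t,x(t))\mid t\in I\}\subset\mathcal{F}$, and satisfying the differential equation on $I$ (one-sided derivative at endpoints belonging to $I$). A global solution is a solution with $I=\mathbb{R}_{\ge 0}$. *)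

theory Defs
  imports "HOL-Analysis.Analysis"
begin

text \<open>
  The minimum is written as a literal least element. It exists whenever \<open>G\<close> is continuous, \<open>K\<close> is
  nonempty and compact and \<open>v0 \<le> 1\<close>.
\<close>

definition control_chi ::
    "(real \<times> real \<times> real \<Rightarrow> real) \<Rightarrow> (real \<times> real) set \<Rightarrow> real \<Rightarrow> real \<Rightarrow> real" where
  "control_chi G K v0 s =
     (LEAST m. m \<in> {v * G (\<rho>, \<xi>, s * v) | \<rho> \<xi> v. (\<rho>, \<xi>) \<in> K \<and> v0 \<le> \<bar>v\<bar> \<and> \<bar>v\<bar> \<le> 1})"

definition control_direction :: "(real \<times> real \<times> real \<Rightarrow> real) \<Rightarrow> real \<Rightarrow> bool" where
  "control_direction G \<eta> \<longleftrightarrow>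
     \<eta> \<in> {-1, 1} \<and>
     (\<forall>K. compact K \<and> K \<noteq> {} \<longrightarrow>
        (\<exists>v0. 0 < v0 \<and> v0 < 1 \<and> (SUP s\<in>{0..}. ereal (control_chi G K v0 (\<eta> * s))) = \<infinity>))"

definition funnel :: "(real \<Rightarrow> real) \<Rightarrow> (real \<times> real) set" where
  "funnel \<phi> = {(t, \<xi>). 0 \<le> t \<and> \<phi> t * \<bar>\<xi>\<bar> < 1}"

text \<open>Only the values of this function on \<open>funnel \<phi>\<close> are meaningful.\<close>

definition funnel_gain :: "(real \<Rightarrow> real) \<Rightarrow> real \<Rightarrow> real \<Rightarrow> real" where
  "funnel_gain \<phi> t \<xi> = \<phi> t * \<xi> / (1 - \<phi> t * \<bar>\<xi>\<bar>)"

text \<open>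
  \<open>ivp_solution F f x0 I x\<close>: the restriction of \<open>x\<close> to \<open>I\<close> solves \<open>x'(t) = f t (x t)\<close>, \<open>x 0 = x0\<close>,
  with graph in \<open>F\<close>. The conditions on \<open>I\<close> describe exactly the intervals \<open>[0,b)\<close> and \<open>[0,b]\<close> with
  \<open>b > 0\<close>, and \<open>[0,\<infinity>)\<close>; derivatives within \<open>I\<close> are one-sided at endpoints belonging to \<open>I\<close>.
\<close>

definition ivp_solution ::
    "(real \<times> real) set \<Rightarrow> (real \<Rightarrow> real \<Rightarrow> real) \<Rightarrow> real \<Rightarrow> real set \<Rightarrow> (real \<Rightarrow> real) \<Rightarrow> bool" where
  "ivp_solution F f x0 I x \<longleftrightarrow>
     is_interval I \<and> 0 \<in> I \<and> I \<subseteq> {0..} \<and> I \<noteq> {0} \<and>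
     continuous_on I x \<and> x 0 = x0 \<and> (\<forall>t\<in>I. (t, x t) \<in> F) \<and>
     (\<forall>t\<in>I. (x has_real_derivative f t (x t)) (at t within I))"

end

theory Submission
  imports Defs "HOL-Complex_Analysis.Great_Picard"
begin

text \<open>
  Write \<open>w = \<phi> t * \<xi>\<close>. Since \<open>\<phi> 0 = 0\<close>, every solution starts on the funnel axis \<open>w = 0\<close>, and on a short
  initial interval it keeps \<open>\<bar>w\<bar> \<le> 1/2\<close>. Afterwards \<open>\<phi>\<close> is bounded away from \<open>0\<close>, so the states lie in a
  compact set, and the control direction \<open>-\<theta>\<close> yields a single input level \<open>s\<close> at which \<open>G\<close> pushes inward
  strongly enough to dominate the growth \<open>\<phi>' \<le> c * (1 + \<phi>)\<close>. The input equals that level exactly where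
  \<open>\<bar>w\<bar> = L = s / (1 + s)\<close>, so \<open>\<bar>w\<bar> = L\<close> is a barrier that no solution crosses. Inside the barrier the
  right-hand side agrees with a bounded continuous one, for which Peano's theorem extends every solution
  to all of \<open>[0,\<infinity>)\<close>, where the barrier applies again. Finally \<open>\<bar>\<xi>\<bar> \<le> L / \<phi> t\<close> tends to \<open>0\<close>.
\<close>

section \<open>Peano existence on a compact time interval, for bounded continuous right-hand
  sides\<close>

lemma continuous_on_compose_pair:
  assumes "continuous_on (T \<times> UNIV) (\<lambda>(t, \<xi>). f t \<xi>)" "continuous_on S x" "S \<subseteq> T"
  shows "continuous_on S (\<lambda>t. f t (x t))"
proof -
  have "continuous_on S ((\<lambda>(t, \<xi>). f t \<xi>) \<circ> (\<lambda>t. (t, x t)))"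
    using assms by (intro continuous_on_compose continuous_on_Pair continuous_on_id
        continuous_on_subset [OF assms(1)]) auto
  then show ?thesis by (simp add: o_def)
qed

lemma integral_diff_norm_le:
  fixes g :: "real \<Rightarrow> 'a::euclidean_space"
  assumes "continuous_on {a..d} g" "\<And>s. s \<in> {a..d} \<Longrightarrow> norm (g s) \<le> B"
    and "u \<in> {a..d}" "v \<in> {a..d}"
  shows "norm (integral {a..u} g - integral {a..v} g) \<le> B * \<bar>u - v\<bar>"
proof -
  have *: "norm (integral {a..u} g - integral {a..v} g) \<le> B * \<bar>u - v\<bar>"
    if "v \<le> u" "u \<in> {a..d}" "v \<in> {a..d}" for u v
  proof -
    have "integral {a..v} g + integral {v..u} g = integral {a..u} g"
      using that by (intro Henstock_Kurzweil_Integration.integral_combine integrable_continuous_real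
          continuous_on_subset [OF assms(1)]) auto
    then have "integral {a..u} g - integral {a..v} g = integral {v..u} g"
      by (metis add_diff_cancel_left')
    moreover have "norm (integral {v..u} g) \<le> B * (u - v)"
      using that assms(2) by (intro integral_bound continuous_on_subset [OF assms(1)]) auto
    ultimately show ?thesis using that by simp
  qed
  show ?thesis
    using *[of v u] *[of u v] assms(3,4)
    by (cases "v \<le> u") (auto simp: norm_minus_commute abs_minus_commute)
qed

text \<open>Delaying the upper limit by \<open>h\<close> makes the \<open>k\<close>-th Picard iterate exact up to time \<open>a + k * h\<close>.\<close>

lemma delayed_integral_equation:
  fixes f :: "real \<Rightarrow> 'a::euclidean_space \<Rightarrow> 'a"
  assumes f: "continuous_on ({a..d} \<times> UNIV) (\<lambda>(t, \<xi>). f t \<xi>)"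
    and B: "\<And>t \<xi>. t \<in> {a..d} \<Longrightarrow> norm (f t \<xi>) \<le> B"
    and h: "0 < h" and ad: "a \<le> d"
  obtains y where "continuous_on {a..d} y"
    "\<And>t. t \<in> {a..d} \<Longrightarrow> y t = y0 + integral {a..max a (t - h)} (\<lambda>s. f s (y s))"
proof -
  \<comment> \<open>Starting from the constant \<open>y0\<close>, the iterates stay constant on the
    first delay interval, where the truncated upper limit \<open>max a (t - h)\<close> equals
    \<open>a\<close>.\<close>
  define Y where "Y = rec_nat (\<lambda>t. y0) (\<lambda>_ y t. y0 + integral {a..max a (t - h)} (\<lambda>s. f s (y s)))"
  have Y0: "Y 0 t = y0" for t by (simp add: Y_def)
  have YS: "Y (Suc k) t = y0 + integral {a..max a (t - h)} (\<lambda>s. f s (Y k s))" for k t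
    by (simp add: Y_def)
  have cont: "continuous_on {a..d} (Y k)" for k
  proof (induction k)
    case 0 then show ?case by (simp add: Y0)
  next
    case (Suc k)
    have "continuous_on {a..d} (\<lambda>s. f s (Y k s))"
      using continuous_on_compose_pair [OF f Suc] by simp
    then have "continuous_on {a..d} (\<lambda>t. integral {a..t} (\<lambda>s. f s (Y k s)))"
      by (intro indefinite_integral_continuous_1 integrable_continuous_real)
    then have "continuous_on {a..d} (\<lambda>t. integral {a..max a (t - h)} (\<lambda>s. f s (Y k s)))"
      by (rule continuous_on_compose2) (use h in \<open>auto intro!: continuous_intros\<close>)
    then show ?case by (simp add: YS [abs_def] continuous_intros)
  qed
  have agree: "Y (Suc k) t = Y k t" if "t \<in> {a..d}" "t \<le> a + real k * h" for k t
    using that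
  proof (induction k arbitrary: t)
    case 0 then show ?case using h by (simp add: YS Y0)
  next
    case (Suc k)
    have "integral {a..max a (t - h)} (\<lambda>s. f s (Y (Suc k) s))
        = integral {a..max a (t - h)} (\<lambda>s. f s (Y k s))"
    proof (rule integral_cong)
      fix s assume s: "s \<in> {a..max a (t - h)}"
      have "a \<le> a + real k * h" using h by simp
      moreover have "t - h \<le> a + real k * h" using Suc.prems by (simp add: algebra_simps)
      ultimately have "s \<le> a + real k * h" using s by auto
      then show "f s (Y (Suc k) s) = f s (Y k s)"
        using Suc.IH [of s] s Suc.prems h by auto
    qed
    then show ?case by (simp only: YS)
  qed
  \<comment> \<open>Finitely many delay steps cover \<open>{a..d}\<close>, so \<open>Y k\<close> and
    \<open>Y (Suc k)\<close> coincide there and \<open>Y k\<close> itself solves the delayed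
    equation.\<close>
  obtain k where k: "(d - a) / h \<le> real k" using real_arch_simple by blast
  then have "d \<le> a + real k * h" using h by (simp add: field_simps)
  with agree cont that [of "Y k"] YS show ?thesis by (metis atLeastAtMost_iff order_trans)
qed

text \<open>The solutions with delay \<open>1 / (n + 1)\<close> are bounded and share the Lipschitz
  constant \<open>B\<close>, so Arzela-Ascoli yields a uniformly convergent subsequence. Continuity
  of \<open>f\<close> and dominated convergence pass to the limit under the integral while the delay
  vanishes. The integral form is kept because it survives gluing and passage to a closure.\<close>

theorem Peano_integral_equation:
  fixes f :: "real \<Rightarrow> 'a::euclidean_space \<Rightarrow> 'a"
  assumes f: "continuous_on ({a..d} \<times> UNIV) (\<lambda>(t, \<xi>). f t \<xi>)"
    and B: "\<And>t \<xi>. t \<in> {a..d} \<Longrightarrow> norm (f t \<xi>) \<le> B"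
    and ad: "a \<le> d"
  obtains y where "continuous_on {a..d} y"
    "\<And>t. t \<in> {a..d} \<Longrightarrow> y t = y0 + integral {a..t} (\<lambda>s. f s (y s))"
proof -
  have "\<exists>y. continuous_on {a..d} y \<and>
      (\<forall>t \<in> {a..d}. y t = y0 + integral {a..max a (t - inverse (real (Suc n)))} (\<lambda>s. f s (y s)))" for n
    by (rule delayed_integral_equation [OF f B, where h = "inverse (real (Suc n))" and ?y0.0 = y0]) (use ad in auto)
  then obtain Y where cY: "\<And>n. continuous_on {a..d} (Y n)"
    and Y: "\<And>n t. t \<in> {a..d} \<Longrightarrow>
      Y n t = y0 + integral {a..max a (t - inverse (real (Suc n)))} (\<lambda>s. f s (Y n s))"
    by metis
  have cf: "continuous_on {a..d} (\<lambda>s. f s (Y n s))" for n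
    using continuous_on_compose_pair [OF f cY] by simp
  have fin: "a \<le> max a (t - inverse (real (Suc n)))" "max a (t - inverse (real (Suc n))) \<in> {a..d}"
    if "t \<in> {a..d}" for t n
  proof -
    have "0 \<le> inverse (real (Suc n))" by simp
    then show "a \<le> max a (t - inverse (real (Suc n)))" "max a (t - inverse (real (Suc n))) \<in> {a..d}"
      using that unfolding atLeastAtMost_iff by linarith+
  qed
  have B0: "0 \<le> B" using order_trans [OF norm_ge_zero B [of a 0]] ad by simp
  \<comment> \<open>Truncating the upper limit is nonexpansive, so the bound does not depend on
    \<open>n\<close>; this is the equicontinuity that Arzela-Ascoli requires.\<close>
  have lip: "norm (Y n t - Y n t') \<le> B * \<bar>t - t'\<bar>" if "t \<in> {a..d}" "t' \<in> {a..d}" for n t t'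
  proof -
    have "norm (Y n t - Y n t') \<le>
        B * \<bar>max a (t - inverse (real (Suc n))) - max a (t' - inverse (real (Suc n)))\<bar>"
      using integral_diff_norm_le [OF cf B fin(2) fin(2), of t t' n n] that by (simp add: Y)
    also have "\<dots> \<le> B * \<bar>t - t'\<bar>" using B0 by (intro mult_left_mono) auto
    finally show ?thesis .
  qed
  have Ya: "Y n a = y0" for n using Y [of a n] ad by simp
  have bnd: "norm (Y n t) \<le> norm y0 + B * (d - a)" if "t \<in> {a..d}" for n t
  proof -
    have "norm (Y n t) \<le> norm (Y n a) + norm (Y n t - Y n a)"
      by (metis norm_triangle_sub)
    also have "\<dots> \<le> norm y0 + B * \<bar>t - a\<bar>" using lip [OF that, of a n] ad by (simp add: Ya)
    also have "\<dots> \<le> norm y0 + B * (d - a)" using that B0 by (simp add: mult_left_mono)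
    finally show ?thesis .
  qed
  obtain y k where cy: "continuous_on {a..d} y" and k: "strict_mono (k :: nat \<Rightarrow> nat)"
    and lim: "\<And>e. 0 < e \<Longrightarrow> \<exists>N. \<forall>n x. n \<ge> N \<and> x \<in> {a..d} \<longrightarrow> norm (Y (k n) x - y x) < e"
  proof (rule Arzela_Ascoli [of "{a..d}" Y "norm y0 + B * (d - a)"])
    fix x e :: real assume x: "x \<in> {a..d}" and e: "0 < e"
    \<comment> \<open>\<open>B + 1\<close> in place of \<open>B\<close> keeps the modulus meaningful
      when \<open>B = 0\<close>.\<close>
    have "norm (Y n x - Y n y) < e" if "y \<in> {a..d}" "norm (x - y) < e / (B + 1)" for n y
    proof -
      have "norm (Y n x - Y n y) \<le> B * \<bar>x - y\<bar>" by (rule lip [OF x that(1)])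
      also have "\<dots> \<le> (B + 1) * \<bar>x - y\<bar>" by (simp add: mult_right_mono)
      also have "\<dots> < e" using that(2) B0 by (simp add: field_simps)
      finally show ?thesis .
    qed
    then show "\<exists>\<delta>>0. \<forall>n y. y \<in> {a..d} \<and> norm (x - y) < \<delta> \<longrightarrow> norm (Y n x - Y n y) < e"
      using e B0 by (intro exI [of _ "e / (B + 1)"]) auto
  qed (use bnd in auto)
  have lim': "(\<lambda>n. Y (k n) t) \<longlonglongrightarrow> y t" if "t \<in> {a..d}" for t
    using lim that by (force simp: LIMSEQ_iff)
  have "y t = y0 + integral {a..t} (\<lambda>s. f s (y s))" if t: "t \<in> {a..d}" for t
  proof (rule LIMSEQ_unique [OF lim' [OF t]])
    have "(\<lambda>n. integral {a..t} (\<lambda>s. f s (Y (k n) s))) \<longlonglongrightarrow> integral {a..t} (\<lambda>s. f s (y s))"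
    proof (rule dominated_convergence(2))
      show "(\<lambda>s. f s (Y (k n) s)) integrable_on {a..t}" for n
        using t by (intro integrable_continuous_real continuous_on_subset [OF cf]) auto
      show "norm (f s (Y (k n) s)) \<le> B" if "s \<in> {a..t}" for n s using that t B by auto
      show "(\<lambda>n. f s (Y (k n) s)) \<longlonglongrightarrow> f s (y s)" if "s \<in> {a..t}" for s
      proof -
        have "(\<lambda>n. case (s, Y (k n) s) of (t, \<xi>) \<Rightarrow> f t \<xi>) \<longlonglongrightarrow> (case (s, y s) of (t, \<xi>) \<Rightarrow> f t \<xi>)"
          by (rule continuous_on_tendsto_compose [OF f]) (use that t lim' [of s] in \<open>auto intro!: tendsto_intros\<close>)
        then show ?thesis by simp
      qed
    qed auto
    \<comment> \<open>The delayed integral differs from the full one by an integral over an interval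
      no longer than the delay, hence by at most \<open>B\<close> times the delay.\<close>
    moreover have "(\<lambda>n. Y (k n) t - y0 - integral {a..t} (\<lambda>s. f s (Y (k n) s))) \<longlonglongrightarrow> 0"
    proof (rule Lim_null_comparison)
      show "\<forall>\<^sub>F n in sequentially. norm (Y (k n) t - y0 - integral {a..t} (\<lambda>s. f s (Y (k n) s)))
          \<le> B * inverse (real (Suc (k n)))"
      proof (rule always_eventually, rule allI)
        fix n
        have "norm (Y (k n) t - y0 - integral {a..t} (\<lambda>s. f s (Y (k n) s)))
          \<le> B * \<bar>max a (t - inverse (real (Suc (k n)))) - t\<bar>"
          using integral_diff_norm_le [OF cf B fin(2) t, of t "k n" "k n"] t by (simp add: Y)
        also have "\<dots> \<le> B * inverse (real (Suc (k n)))"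
          using B0 t by (intro mult_left_mono) (auto simp: max_def)
        finally show "norm (Y (k n) t - y0 - integral {a..t} (\<lambda>s. f s (Y (k n) s)))
          \<le> B * inverse (real (Suc (k n)))" .
      qed
      have "(\<lambda>n. inverse (real (Suc (k n)))) \<longlonglongrightarrow> 0"
        using LIMSEQ_subseq_LIMSEQ [OF LIMSEQ_inverse_real_of_nat k] by (simp add: o_def)
      then show "(\<lambda>n. B * inverse (real (Suc (k n)))) \<longlonglongrightarrow> 0"
        by (rule tendsto_mult_right_zero)
    qed
    ultimately show "(\<lambda>n. Y (k n) t) \<longlonglongrightarrow> y0 + integral {a..t} (\<lambda>s. f s (y s))"
      using tendsto_add [OF tendsto_add [OF _ tendsto_const [of y0]]] by fastforce
  qed
  with cy that show ?thesis by blast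
qed

section \<open>Continuation of solutions to the half-line\<close>

text \<open>Peano's theorem is restarted at \<open>b\<close> with initial value \<open>x b\<close>,
  and additivity of the integral merges the two equations. The values on \<open>{0..b}\<close> are
  kept, which makes repeated extensions coherent.\<close>

lemma integral_equation_step:
  fixes f :: "real \<Rightarrow> 'a::euclidean_space \<Rightarrow> 'a"
  assumes f: "continuous_on ({0..} \<times> UNIV) (\<lambda>(t, \<xi>). f t \<xi>)"
    and B: "\<And>t \<xi>. 0 \<le> t \<Longrightarrow> norm (f t \<xi>) \<le> B"
    and b: "0 \<le> b" and d: "b \<le> d" and x: "continuous_on {0..b} x"
    and eq: "\<And>t. t \<in> {0..b} \<Longrightarrow> x t = y0 + integral {0..t} (\<lambda>s. f s (x s))"
  obtains y where "continuous_on {0..d} y" "\<And>t. t \<in> {0..b} \<Longrightarrow> y t = x t"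
    "\<And>t. t \<in> {0..d} \<Longrightarrow> y t = y0 + integral {0..t} (\<lambda>s. f s (y s))"
proof -
  have fbd: "continuous_on ({b..d} \<times> UNIV) (\<lambda>(t, \<xi>). f t \<xi>)"
    using b by (intro continuous_on_subset [OF f]) auto
  obtain z where cz: "continuous_on {b..d} z"
    and z: "\<And>t. t \<in> {b..d} \<Longrightarrow> z t = x b + integral {b..t} (\<lambda>s. f s (z s))"
    using Peano_integral_equation [OF fbd, of B "x b"] B b d by auto
  have zb: "z b = x b" using z [of b] d by simp
  define y where "y = (\<lambda>t. if t \<le> b then x t else z t)"
  have yx: "y t = x t" if "t \<in> {0..b}" for t using that by (simp add: y_def)
  have yz: "y t = z t" if "t \<in> {b..d}" for t using that zb by (auto simp: y_def)
  have cy: "continuous_on {0..d} y"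
  proof -
    have "{0..d} = {0..b} \<union> {b..d}" using b d by auto
    moreover have "continuous_on ({0..b} \<union> {b..d}) y"
    proof (intro continuous_on_closed_Un)
      show "continuous_on {0..b} y" using x by (rule continuous_on_eq) (simp add: yx)
      show "continuous_on {b..d} y" using cz by (rule continuous_on_eq) (simp add: yz)
    qed auto
    ultimately show ?thesis by simp
  qed
  have cfy: "continuous_on {0..d} (\<lambda>s. f s (y s))"
    using continuous_on_compose_pair [OF f cy] by simp
  have "y t = y0 + integral {0..t} (\<lambda>s. f s (y s))" if t: "t \<in> {0..d}" for t
  proof (cases "t \<le> b")
    case True
    then have "integral {0..t} (\<lambda>s. f s (y s)) = integral {0..t} (\<lambda>s. f s (x s))"
      by (intro integral_cong) (simp add: yx)
    then show ?thesis using True t eq [of t] by (simp add: yx)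
  next
    case False
    have "integral {0..b} (\<lambda>s. f s (y s)) = integral {0..b} (\<lambda>s. f s (x s))"
      by (intro integral_cong) (simp add: yx)
    moreover have "integral {b..t} (\<lambda>s. f s (y s)) = integral {b..t} (\<lambda>s. f s (z s))"
      using t by (intro integral_cong) (simp add: yz)
    moreover have "integral {0..b} (\<lambda>s. f s (y s)) + integral {b..t} (\<lambda>s. f s (y s))
        = integral {0..t} (\<lambda>s. f s (y s))"
      using t b False by (intro Henstock_Kurzweil_Integration.integral_combine
          integrable_continuous_real continuous_on_subset [OF cfy]) auto
    moreover have "y t = z t" using False t by (intro yz) simp
    ultimately show ?thesis
      using z [of t] eq [of b] False t b by (simp add: add.assoc [symmetric])
  qed
  with that cy yx show ?thesis by blast
qed

text \<open>Extensions by unit length are picked one after another. Solutions need not be unique, so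
  each is chosen, by dependent choice, as an extension of its predecessor; the nested family then
  has a common union.\<close>

lemma integral_equation_global:
  fixes f :: "real \<Rightarrow> 'a::euclidean_space \<Rightarrow> 'a"
  assumes f: "continuous_on ({0..} \<times> UNIV) (\<lambda>(t, \<xi>). f t \<xi>)"
    and B: "\<And>t \<xi>. 0 \<le> t \<Longrightarrow> norm (f t \<xi>) \<le> B"
    and b: "0 \<le> b" and x: "continuous_on {0..b} x"
    and eq: "\<And>t. t \<in> {0..b} \<Longrightarrow> x t = y0 + integral {0..t} (\<lambda>s. f s (x s))"
  obtains y where "continuous_on {0..} y" "\<And>t. t \<in> {0..b} \<Longrightarrow> y t = x t"
    "\<And>t. 0 \<le> t \<Longrightarrow> y t = y0 + integral {0..t} (\<lambda>s. f s (y s))"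
proof -
  define P where "P = (\<lambda>n z. continuous_on {0..b + real n} z \<and>
    (\<forall>t \<in> {0..b + real n}. z t = y0 + integral {0..t} (\<lambda>s. f s (z s))) \<and> (\<forall>t \<in> {0..b}. z t = x t))"
  have "\<exists>X. \<forall>n. P n (X n) \<and> (\<forall>t \<in> {0..b + real n}. X (Suc n) t = X n t)"
  proof (rule dependent_nat_choice)
    show "\<exists>z. P 0 z" unfolding P_def of_nat_0 add_0_right using x eq by blast
    fix z n assume z: "P n z"
    have zc: "continuous_on {0..b + real n} z" and zx: "\<And>t. t \<in> {0..b} \<Longrightarrow> z t = x t"
      and ze: "\<And>t. t \<in> {0..b + real n} \<Longrightarrow> z t = y0 + integral {0..t} (\<lambda>s. f s (z s))"
      using z unfolding P_def by blast+
    have bn: "0 \<le> b + real n" "b + real n \<le> b + real (Suc n)" using b by auto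
    obtain y where y: "continuous_on {0..b + real (Suc n)} y"
      "\<And>t. t \<in> {0..b + real n} \<Longrightarrow> y t = z t"
      "\<And>t. t \<in> {0..b + real (Suc n)} \<Longrightarrow> y t = y0 + integral {0..t} (\<lambda>s. f s (y s))"
      using integral_equation_step [OF f B bn zc ze] by blast
    have "y t = x t" if "t \<in> {0..b}" for t using y(2) [of t] zx [OF that] that by simp
    with y show "\<exists>y. P (Suc n) y \<and> (\<forall>t \<in> {0..b + real n}. y t = z t)"
      unfolding P_def by blast
  qed
  then obtain X where P: "\<And>n. P n (X n)"
    and X: "\<And>n t. t \<in> {0..b + real n} \<Longrightarrow> X (Suc n) t = X n t" by blast
  have agree: "X m t = X n t" if "n \<le> m" "t \<in> {0..b + real n}" for n m t
    using that(1)
  proof (induction m rule: dec_induct)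
    case (step m)
    then show ?case using X [of t m] that(2) by auto
  qed simp
  \<comment> \<open>For \<open>t \<ge> 0\<close>, every index whose interval contains
    \<open>t\<close> gives the same value, and rounding \<open>t\<close> up is such an index because
    \<open>b \<ge> 0\<close>.\<close>
  define y where "y = (\<lambda>t. X (nat \<lceil>t\<rceil>) t)"
  have yX: "y t = X n t" if t: "t \<in> {0..b + real n}" for n t
  proof -
    have "t \<in> {0..b + real (nat \<lceil>t\<rceil>)}" using t b by (simp, linarith)
    with t have "X (nat \<lceil>t\<rceil>) t = X n t"
      using agree [of n "nat \<lceil>t\<rceil>" t] agree [of "nat \<lceil>t\<rceil>" n t] by (metis nle_le)
    then show ?thesis by (simp only: y_def)
  qed
  have big: "\<exists>n. t < b + real n" if "0 \<le> t" for t
    using reals_Archimedean2 [of "t - b"] by (auto simp: algebra_simps)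
  have "continuous_on {0..} y"
    unfolding continuous_on_eq_continuous_within
  proof
    fix t :: real assume t: "t \<in> {0..}"
    obtain n where n: "t < b + real n" using big t by auto
    have "continuous_on {0..b + real n} (X n)" using P [of n] unfolding P_def by blast
    then have "continuous_on {0..b + real n} y" by (rule continuous_on_eq) (simp only: yX)
    then have "continuous (at t within {0..b + real n}) y"
      using t n by (auto simp: continuous_on_eq_continuous_within)
    \<comment> \<open>Since \<open>t < b + real n\<close> is strict, the right endpoint is invisible
      near \<open>t\<close>, and continuity of one member of the family is enough.\<close>
    moreover have "at t within {0..b + real n} = at t within {0..}"
      by (rule at_within_nhd [of _ "{..<b + real n}"]) (use n in auto)
    ultimately show "continuous (at t within {0..}) y" by simp
  qed
  moreover have "y t = x t" if "t \<in> {0..b}" for t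
  proof -
    have "X 0 t = x t" using P [of 0] that unfolding P_def by blast
    then show ?thesis using yX [of t 0] that by simp
  qed
  moreover have "y t = y0 + integral {0..t} (\<lambda>s. f s (y s))" if t: "0 \<le> t" for t
  proof -
    obtain n where n: "t < b + real n" using big t by auto
    have "integral {0..t} (\<lambda>s. f s (y s)) = integral {0..t} (\<lambda>s. f s (X n s))"
      using n by (intro integral_cong) (subst yX [of _ n], auto)
    moreover have "X n t = y0 + integral {0..t} (\<lambda>s. f s (X n s))"
      using P [of n] t n unfolding P_def by (meson atLeastAtMost_iff less_imp_le)
    moreover have "y t = X n t" using t n by (intro yX) simp
    ultimately show ?thesis by simp
  qed
  ultimately show ?thesis using that by blast
qed

theorem Peano_global_extension:
  fixes f :: "real \<Rightarrow> 'a::euclidean_space \<Rightarrow> 'a"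
  assumes f: "continuous_on ({0..} \<times> UNIV) (\<lambda>(t, \<xi>). f t \<xi>)"
    and B: "\<And>t \<xi>. 0 \<le> t \<Longrightarrow> norm (f t \<xi>) \<le> B"
    and I: "is_interval I" "0 \<in> I" "I \<subseteq> {0..}"
    and x: "\<And>t. t \<in> I \<Longrightarrow> (x has_vector_derivative f t (x t)) (at t within I)"
  obtains y where "\<And>t. t \<in> I \<Longrightarrow> y t = x t"
    "\<And>t. 0 \<le> t \<Longrightarrow> (y has_vector_derivative f t (y t)) (at t within {0..})"
proof (cases "bounded I")
  case False
  have "t \<in> I" if "0 \<le> t" for t
  proof -
    have "\<not> I \<subseteq> {0..t}" using False bounded_subset bounded_closed_interval by blast
    then obtain s where "s \<in> I" "t < s" using I(3) by force
    then show ?thesis using mem_is_interval_1_I [OF I(1,2)] that by auto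
  qed
  then have "I = {0..}" using I(3) by auto
  then show ?thesis using that [of x] x by auto
next
  case True
  have sub: "{0..t} \<subseteq> I" if "t \<in> I" for t
    using mem_is_interval_1_I [OF I(1,2) that] by auto
  have cx: "continuous_on I x"
    using x by (auto simp: continuous_on_eq_continuous_within intro: has_vector_derivative_continuous)
  have cfx: "continuous_on I (\<lambda>s. f s (x s))"
    using continuous_on_compose_pair [OF f cx] I by simp
  have eq: "x t = x 0 + integral {0..t} (\<lambda>s. f s (x s))" if "t \<in> I" for t
  proof -
    have "((\<lambda>s. f s (x s)) has_integral x t - x 0) {0..t}"
      using sub [OF that] I that
      by (intro fundamental_theorem_of_calculus has_vector_derivative_within_subset [OF x]) auto
    then show ?thesis by (simp add: integral_unique)
  qed
  have "norm (x s - x t) \<le> B * \<bar>s - t\<bar>" if st: "s \<in> I" "t \<in> I" for s t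
  proof -
    have "{0..max s t} \<subseteq> I" using sub st by (simp add: max_def)
    then have "continuous_on {0..max s t} (\<lambda>s. f s (x s))"
      using continuous_on_subset [OF cfx] by blast
    then show ?thesis
      using integral_diff_norm_le [of 0 "max s t" "\<lambda>s. f s (x s)" B s t] B st I eq [of s] eq [of t]
      by (auto simp: subset_iff)
  qed
  then have "B-lipschitz_on I x"
    using order_trans [OF norm_ge_zero B [of 0 0]]
    by (intro lipschitz_onI) (auto simp: dist_norm dist_real_def)
  then obtain z where cz: "continuous_on (closure I) z" and z: "\<And>t. t \<in> I \<Longrightarrow> x t = z t"
    using uniformly_continuous_on_extension_on_closure [OF lipschitz_on_uniformly_continuous]
      uniformly_continuous_imp_continuous by metis
  have "connected (closure I)" "compact (closure I)"
    using I(1) True by (auto simp: is_interval_connected_1 intro: connected_imp_connected_closure)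
  then obtain a b where ab: "closure I = {a..b}"
    using connected_compact_interval_1 by blast
  have "closure I \<subseteq> {0..}" using I(3) closure_minimal closed_atLeast by blast
  moreover have "0 \<in> closure I" using I(2) closure_subset by blast
  ultimately have cl: "closure I = {0..b}" and b: "0 \<le> b" using ab by auto
  have cfz: "continuous_on {0..b} (\<lambda>s. f s (z s))"
    using continuous_on_compose_pair [OF f cz] cl by simp
  have zeq: "z t = x 0 + integral {0..t} (\<lambda>s. f s (z s))" if t: "t \<in> {0..b}" for t
  proof -
    \<comment> \<open>This difference is continuous on the closure and equals the constant
      \<open>x 0\<close> on \<open>I\<close>, hence equals it on the closure by density.\<close>
    have "continuous_on (closure I) (\<lambda>t. z t - integral {0..t} (\<lambda>s. f s (z s)))"
      unfolding cl using cz cl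
      by (intro continuous_intros indefinite_integral_continuous_1 integrable_continuous_real cfz) simp
    moreover have "z t - integral {0..t} (\<lambda>s. f s (z s)) = x 0" if "t \<in> I" for t
    proof -
      have "integral {0..t} (\<lambda>s. f s (z s)) = integral {0..t} (\<lambda>s. f s (x s))"
        using sub [OF that] by (intro integral_cong) (auto simp: z)
      then show ?thesis using eq [OF that] z [OF that] by simp
    qed
    ultimately have "z t - integral {0..t} (\<lambda>s. f s (z s)) = x 0"
      using t cl continuous_constant_on_closure [of I] by blast
    then show ?thesis by (simp add: algebra_simps)
  qed
  obtain y where cy: "continuous_on {0..} y" and yz: "\<And>t. t \<in> {0..b} \<Longrightarrow> y t = z t"
    and y: "\<And>t. 0 \<le> t \<Longrightarrow> y t = x 0 + integral {0..t} (\<lambda>s. f s (y s))"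
    using integral_equation_global [OF f B b cz [unfolded cl] zeq] by blast
  have cfy: "continuous_on {0..} (\<lambda>s. f s (y s))"
    using continuous_on_compose_pair [OF f cy] by simp
  show ?thesis
  proof
    show "y t = x t" if "t \<in> I" for t
    proof -
      have "t \<in> {0..b}" using that closure_subset cl by blast
      then show ?thesis using yz z [OF that] by simp
    qed
    fix t :: real assume t: "0 \<le> t"
    have "((\<lambda>t. integral {0..t} (\<lambda>s. f s (y s))) has_vector_derivative f t (y t)) (at t within {0..t + 1})"
      by (rule integral_has_vector_derivative) (use t in \<open>auto intro: continuous_on_subset [OF cfy]\<close>)
    then have "((\<lambda>t. x 0 + integral {0..t} (\<lambda>s. f s (y s))) has_vector_derivative f t (y t))
        (at t within {0..t + 1})"
      by (auto intro!: derivative_eq_intros)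
    then have "(y has_vector_derivative f t (y t)) (at t within {0..t + 1})"
      by (rule has_vector_derivative_transform [rotated 2]) (use t y in \<open>simp_all only: atLeastAtMost_iff\<close>, simp)
    moreover have "at t within {0..t + 1} = at t within {0..}"
      by (rule at_within_nhd [of _ "{..<t + 1}"]) auto
    ultimately show "(y has_vector_derivative f t (y t)) (at t within {0..})" by simp
  qed
qed

section \<open>A barrier principle and the funnel function\<close>

text \<open>At the first time \<open>r\<close> with \<open>w r \<ge> 0\<close>, the intermediate
  value theorem gives \<open>w r = 0\<close>; a negative derivative there makes \<open>w\<close>
  positive just before \<open>r\<close>, contradicting minimality. The derivative is requested only
  at zeros of \<open>w\<close>, so a differential equation has to be known only at contact with the
  barrier.\<close>

lemma barrier_negative:
  fixes w w' :: "real \<Rightarrow> real"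
  assumes cont: "continuous_on {a..b} w" and wa: "w a < 0"
    and w': "\<And>t. t \<in> {a..b} \<Longrightarrow> w t = 0 \<Longrightarrow>
      (w has_real_derivative w' t) (at t within {a..b}) \<and> w' t < 0"
    and t: "t \<in> {a..b}"
  shows "w t < 0"
proof (rule ccontr)
  assume "\<not> w t < 0"
  define T where "T = {s \<in> {a..b}. w s \<in> {0..}}"
  have "t \<in> T" using t \<open>\<not> w t < 0\<close> by (simp add: T_def)
  have "closed T"
    using continuous_closed_preimage [OF cont, of "{0..}"] by (simp add: T_def Int_def vimage_def)
  moreover have "T \<subseteq> {a..b}" by (auto simp: T_def)
  ultimately have "compact T" by (meson bounded_closed_interval bounded_subset compact_eq_bounded_closed)
  then obtain r where r: "r \<in> T" and least: "\<And>s. s \<in> T \<Longrightarrow> r \<le> s"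
    using compact_attains_inf [of T] \<open>t \<in> T\<close> by blast
  have before: "w s < 0" if "s \<in> {a..b}" "s < r" for s
    using least [of s] that by (force simp: T_def)
  have rab: "r \<in> {a..b}" "0 \<le> w r" using r by (auto simp: T_def)
  have "w r = 0"
  proof (rule ccontr)
    assume "w r \<noteq> 0"
    obtain s where "a \<le> s" "s \<le> r" "w s = 0"
      using IVT' [of w a 0 r] wa rab continuous_on_subset [OF cont, of "{a..r}"] by auto
    then show False using before [of s] \<open>w r \<noteq> 0\<close> rab by (cases "s = r") auto
  qed
  then have d: "(w has_real_derivative w' r) (at r within {a..b})" "w' r < 0"
    using w' rab by blast+
  have "a < r" using wa rab \<open>w r = 0\<close> by (cases "a = r") auto
  obtain e where e: "0 < e" "\<And>h. 0 < h \<Longrightarrow> r - h \<in> {a..b} \<Longrightarrow> h < e \<Longrightarrow> w r < w (r - h)"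
    using has_real_derivative_neg_dec_left [OF d] by blast
  define h where "h = min (e / 2) (r - a)"
  have "0 < h" "h < e" "r - h \<in> {a..b}" using e(1) \<open>a < r\<close> rab by (auto simp: h_def min_def)
  then show False using e(2) [of h] before [of "r - h"] \<open>w r = 0\<close> by auto
qed

text \<open>A continuous injection on an interval is monotone. A decrease from \<open>s\<close> to
  \<open>t\<close> would therefore bound \<open>\<phi>\<close> from above, by compactness up to
  \<open>t\<close> and by \<open>\<phi> s\<close> afterwards, against surjectivity.\<close>

lemma bij_nonneg_strict_mono:
  fixes \<phi> :: "real \<Rightarrow> real"
  assumes bij: "bij_betw \<phi> {0..} {0..}" and cont: "continuous_on {0..} \<phi>"
  shows "strict_mono_on {0..} \<phi>" "\<phi> 0 = 0"
proof -
  have inj: "inj_on \<phi> {0..}" and img: "\<phi> ` {0..} = {0..}"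
    using bij by (auto simp: bij_betw_def)
  have less: "\<phi> s < \<phi> t" if st: "0 \<le> s" "s < t" for s t
  proof (rule ccontr)
    assume "\<not> \<phi> s < \<phi> t"
    moreover have "\<phi> s \<noteq> \<phi> t" using inj st by (auto dest: inj_onD)
    ultimately have ts: "\<phi> t < \<phi> s" by simp
    have after: "\<phi> r < \<phi> s" if "t < r" for r
    proof -
      have "inj_on \<phi> {s..r}" using st by (intro inj_on_subset [OF inj]) auto
      moreover have "continuous_on {s..r} \<phi>" using st by (intro continuous_on_subset [OF cont]) auto
      ultimately show ?thesis
        using continuous_inj_imp_mono [of s t r \<phi>] st that ts by auto
    qed
    have "bounded (\<phi> ` {0..t})"
      using st by (intro compact_imp_bounded compact_continuous_image continuous_on_subset [OF cont]) auto
    then obtain C where C: "\<forall>r\<in>{0..t}. \<bar>\<phi> r\<bar> \<le> C" by (auto simp: bounded_iff)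
    have "max C (\<phi> s) + 1 \<in> \<phi> ` {0..}"
      unfolding img using bspec [OF C, of 0] st by auto
    then obtain r where "0 \<le> r" "\<phi> r = max C (\<phi> s) + 1" by auto
    then show False using bspec [OF C, of r] after [of r] by (cases "r \<le> t") auto
  qed
  then show "strict_mono_on {0..} \<phi>" by (auto intro: strict_mono_onI)
  obtain t where t: "0 \<le> t" "\<phi> t = 0" using img by (metis atLeast_iff image_iff order_refl)
  have "0 \<le> \<phi> 0" using img by auto
  then show "\<phi> 0 = 0" using less [of 0 t] t by (cases "t = 0") auto
qed

section \<open>Input levels from control directions, and confinement\<close>

text \<open>The admissible \<open>v\<close> form two compact intervals, so the set of values is a
  compact image and the \<open>LEAST\<close> in the definition is an attained minimum.\<close>

lemma control_chi_le:
  assumes G: "continuous_on UNIV G" and K: "compact K" and v0: "0 < v0" "v0 < 1"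
    and "(\<rho>, \<xi>) \<in> K" "v0 \<le> \<bar>v\<bar>" "\<bar>v\<bar> \<le> 1"
  shows "control_chi G K v0 s \<le> v * G (\<rho>, \<xi>, s * v)"
proof -
  define V where "V = {-1..-v0} \<union> {v0..(1::real)}"
  define E where "E = (\<lambda>((\<rho>, \<xi>), v). v * G (\<rho>, \<xi>, s * v)) ` (K \<times> V)"
  have V: "v \<in> V \<longleftrightarrow> v0 \<le> \<bar>v\<bar> \<and> \<bar>v\<bar> \<le> 1" for v using v0 by (auto simp: V_def)
  have E: "{v * G (\<rho>, \<xi>, s * v) | \<rho> \<xi> v. (\<rho>, \<xi>) \<in> K \<and> v0 \<le> \<bar>v\<bar> \<and> \<bar>v\<bar> \<le> 1} = E"
    unfolding E_def V [symmetric] by (force simp: image_iff)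
  have "continuous_on (K \<times> V) (\<lambda>((\<rho>, \<xi>), v). v * G (\<rho>, \<xi>, s * v))"
    unfolding case_prod_beta
    by (intro continuous_intros continuous_on_compose2 [OF G]) auto
  then have "compact E"
    unfolding E_def using K by (intro compact_continuous_image compact_Times) (auto simp: V_def)
  moreover have mem: "v * G (\<rho>, \<xi>, s * v) \<in> E" using E assms(5-7) by blast
  ultimately obtain m where m: "m \<in> E" "\<And>e. e \<in> E \<Longrightarrow> m \<le> e"
    using compact_attains_inf [of E] by blast
  then have "control_chi G K v0 s = m"
    unfolding control_chi_def E by (intro Least_equality) auto
  then show ?thesis using m mem by simp
qed

text \<open>Only the extreme values \<open>v = 1\<close> and \<open>v = -1\<close> in the definition of a control direction matter.
  The gain \<open>s\<close> can be taken large because the values of \<open>control_chi\<close> at bounded arguments are bounded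
  above.\<close>

lemma control_direction_level:
  assumes G: "continuous_on UNIV G" and \<eta>: "control_direction G \<eta>"
    and K: "compact K" "K \<noteq> {}"
  obtains s where "r < s" "\<And>\<rho> \<xi>. (\<rho>, \<xi>) \<in> K \<Longrightarrow> M < G (\<rho>, \<xi>, \<eta> * s)"
    "\<And>\<rho> \<xi>. (\<rho>, \<xi>) \<in> K \<Longrightarrow> G (\<rho>, \<xi>, - (\<eta> * s)) < - M"
proof -
  obtain v0 where v0: "0 < v0" "v0 < 1"
    and sup: "(SUP s\<in>{0..}. ereal (control_chi G K v0 (\<eta> * s))) = \<infinity>"
    using \<eta> K by (auto simp: control_direction_def)
  obtain \<rho> \<xi> where K0: "(\<rho>, \<xi>) \<in> K" using K by auto
  have "bounded ((\<lambda>s. G (\<rho>, \<xi>, \<eta> * s)) ` {0..r})"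
    by (intro compact_imp_bounded compact_continuous_image continuous_intros
        continuous_on_compose2 [OF G]) auto
  \<comment> \<open>A bound at a single point of \<open>K\<close> serves, since
    \<open>control_chi\<close> is a minimum over \<open>K\<close> and so lies below the value at
    that point with \<open>v = 1\<close>.\<close>
  then obtain C where C: "\<forall>s\<in>{0..r}. \<bar>G (\<rho>, \<xi>, \<eta> * s)\<bar> \<le> C" by (auto simp: bounded_iff)
  define m where "m = max M C"
  have "ereal m < (SUP s\<in>{0..}. ereal (control_chi G K v0 (\<eta> * s)))" by (simp add: sup)
  then obtain s where s: "0 \<le> s" "m < control_chi G K v0 (\<eta> * s)"
    by (auto simp: less_SUP_iff)
  have chi: "control_chi G K v0 (\<eta> * s) \<le> v * G (\<rho>, \<xi>, \<eta> * s * v)"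
    if "(\<rho>, \<xi>) \<in> K" "\<bar>v\<bar> = 1" for \<rho> \<xi> v
    using control_chi_le [OF G K(1) v0] that v0 by simp
  show ?thesis
  proof
    show "r < s"
    proof (rule ccontr)
      assume "\<not> r < s"
      then show False using bspec [OF C, of s] chi [OF K0, of 1] s by (auto simp: m_def)
    qed
    show "M < G (\<rho>, \<xi>, \<eta> * s)" if "(\<rho>, \<xi>) \<in> K" for \<rho> \<xi>
      using chi [OF that, of 1] s by (simp add: m_def)
    show "G (\<rho>, \<xi>, - (\<eta> * s)) < - M" if "(\<rho>, \<xi>) \<in> K" for \<rho> \<xi>
      using chi [OF that, of "-1"] s by (simp add: m_def)
  qed
qed

text \<open>The differential equation is required only inside the region to which the solution is to be confined,
  so the lemma applies to the original and to the saturated right-hand side alike.\<close>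

lemma funnel_trap:
  fixes \<phi> \<phi>' x :: "real \<Rightarrow> real"
  assumes I: "is_interval I" "0 \<in> I" "I \<subseteq> {0..}" and x: "continuous_on I x"
    and x': "\<And>t. t \<in> I \<Longrightarrow> \<phi> t * \<bar>x t\<bar> \<le> L \<Longrightarrow> \<bar>x t\<bar> \<le> R \<Longrightarrow>
      (x has_real_derivative f t (x t)) (at t within I)"
    and \<phi>': "\<And>t. 0 \<le> t \<Longrightarrow> (\<phi> has_real_derivative \<phi>' t) (at t within {0..})"
    and mono: "mono_on {0..} \<phi>" and \<phi>0: "0 \<le> \<phi> 0"
    and L: "1 / 2 < L" "L < 1"
    and d: "0 < d" "0 < \<phi> d" "\<phi> d * (\<bar>x 0\<bar> + 1) \<le> 1 / 2" "(B + 1) * d \<le> 1 / 2"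
    and R: "\<bar>x 0\<bar> + 1 \<le> R" "1 / \<phi> d \<le> R"
    and B: "\<And>t \<xi>. 0 \<le> t \<Longrightarrow> t \<le> d \<Longrightarrow> \<bar>\<xi>\<bar> \<le> \<bar>x 0\<bar> + 1 \<Longrightarrow> \<bar>f t \<xi>\<bar> \<le> B"
    and upper: "\<And>t \<xi>. d \<le> t \<Longrightarrow> \<phi> t * \<xi> = L \<Longrightarrow> \<phi>' t * \<xi> + \<phi> t * f t \<xi> < 0"
    and lower: "\<And>t \<xi>. d \<le> t \<Longrightarrow> \<phi> t * \<xi> = - L \<Longrightarrow> 0 < \<phi>' t * \<xi> + \<phi> t * f t \<xi>"
    and t: "t \<in> I"
  shows "\<phi> t * \<bar>x t\<bar> \<le> L" "\<bar>x t\<bar> \<le> R"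
proof -
  have sub: "{0..t} \<subseteq> I" if "t \<in> I" for t
    using mem_is_interval_1_I [OF I(1,2) that] by auto
  have B0: "0 \<le> B" using B [of 0 0] d by auto
  have m: "\<phi> s \<le> \<phi> t" if "0 \<le> s" "s \<le> t" for s t
    using mono that by (auto simp: mono_on_def)
  have small: "\<phi> s * \<bar>\<xi>\<bar> \<le> 1 / 2" if "0 \<le> s" "s \<le> d" "\<bar>\<xi>\<bar> \<le> \<bar>x 0\<bar> + 1" for s \<xi>
  proof -
    have "\<phi> s * \<bar>\<xi>\<bar> \<le> \<phi> d * (\<bar>x 0\<bar> + 1)"
      using m [of s d] that d by (intro mult_mono) auto
    then show ?thesis using d by simp
  qed
  have early: "\<bar>x t\<bar> \<le> \<bar>x 0\<bar> + 1" if t: "t \<in> I" "t \<le> d" for t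
  proof -
    have t0: "0 \<le> t" using t I by auto
    \<comment> \<open>The moving barrier starts at \<open>1 / 2\<close> and has slope
      \<open>B + 1\<close>, steeper than the solution can be. Up to time \<open>d\<close> it stays
      below \<open>1\<close>, so the bound \<open>B\<close> on \<open>f\<close> is available at any
      contact. The sign \<open>\<sigma>\<close> treats both sides at once.\<close>
    have "\<sigma> * (x t - x 0) - (B + 1) * t - 1 / 2 < 0" if \<sigma>: "\<sigma> \<in> {-1, 1}" for \<sigma> :: real
    proof (rule barrier_negative [where a = 0 and b = t and
        w = "\<lambda>t. \<sigma> * (x t - x 0) - (B + 1) * t - 1 / 2" and w' = "\<lambda>t. \<sigma> * f t (x t) - (B + 1)"])
      show "continuous_on {0..t} (\<lambda>t. \<sigma> * (x t - x 0) - (B + 1) * t - 1 / 2)"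
        using sub [OF t(1)] by (intro continuous_intros continuous_on_subset [OF x])
      fix s assume s: "s \<in> {0..t}" and z: "\<sigma> * (x s - x 0) - (B + 1) * s - 1 / 2 = 0"
      have "(B + 1) * s \<le> (B + 1) * d" using s t B0 by (intro mult_left_mono) auto
      moreover have "0 \<le> (B + 1) * s" using s B0 by simp
      ultimately have xs: "\<bar>x s\<bar> \<le> \<bar>x 0\<bar> + 1" using z \<sigma> d by auto
      have "(x has_real_derivative f s (x s)) (at s within I)"
        using s sub [OF t(1)] xs small [of s "x s"] t L R by (intro x') auto
      then have "(x has_real_derivative f s (x s)) (at s within {0..t})"
        by (rule DERIV_subset [OF _ sub [OF t(1)]])
      moreover have "\<bar>f s (x s)\<bar> \<le> B" using B s t xs by simp
      ultimately show "((\<lambda>t. \<sigma> * (x t - x 0) - (B + 1) * t - 1 / 2) has_real_derivative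
          \<sigma> * f s (x s) - (B + 1)) (at s within {0..t}) \<and> \<sigma> * f s (x s) - (B + 1) < 0"
        using \<sigma> by (auto intro!: derivative_eq_intros)
    qed (use t0 in auto)
    from this [of 1] this [of "-1"] have "\<bar>x t - x 0\<bar> < (B + 1) * t + 1 / 2" by auto
    moreover have "(B + 1) * t \<le> (B + 1) * d" using t B0 by (intro mult_left_mono) auto
    ultimately show ?thesis using d by auto
  qed
  have late: "\<phi> t * \<bar>x t\<bar> < L" if t: "t \<in> I" "d \<le> t" for t
  proof -
    have dt: "{d..t} \<subseteq> I" using sub [OF t(1)] d by auto
    have c\<phi>: "continuous_on {0..} \<phi>"
      using \<phi>' by (auto simp: continuous_on_eq_continuous_within intro: DERIV_continuous)
    \<comment> \<open>From time \<open>d\<close> on, the barrier is \<open>L\<close> for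
      \<open>\<bar>\<phi> t * x t\<bar>\<close>. It starts strictly inside, at most
      \<open>1 / 2 < L\<close>; \<open>upper\<close> and \<open>lower\<close> give the sign of the
      derivative of \<open>\<phi> * x\<close> at contact.\<close>
    have "\<sigma> * (\<phi> t * x t) - L < 0" if \<sigma>: "\<sigma> \<in> {-1, 1}" for \<sigma> :: real
    proof (rule barrier_negative [where a = d and b = t and
        w = "\<lambda>t. \<sigma> * (\<phi> t * x t) - L" and w' = "\<lambda>t. \<sigma> * (\<phi>' t * x t + \<phi> t * f t (x t))"])
      show "continuous_on {d..t} (\<lambda>t. \<sigma> * (\<phi> t * x t) - L)"
        using dt d by (intro continuous_intros continuous_on_subset [OF x]
            continuous_on_subset [OF c\<phi>]) auto
      have "\<phi> d * \<bar>x d\<bar> \<le> 1 / 2" using early [of d] dt t d by (intro small) auto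
      then have "\<bar>\<sigma> * (\<phi> d * x d)\<bar> \<le> 1 / 2" using d \<sigma> by (auto simp: abs_mult)
      then show "\<sigma> * (\<phi> d * x d) - L < 0" using L by linarith
      fix s assume s: "s \<in> {d..t}" and z: "\<sigma> * (\<phi> s * x s) - L = 0"
      have s0: "0 < \<phi> s" "\<phi> d \<le> \<phi> s" using m [of d s] s d by auto
      have zz: "\<phi> s * x s = \<sigma> * L" using z \<sigma> by auto
      have "\<phi> s * \<bar>x s\<bar> = \<bar>\<phi> s * x s\<bar>" using s0 by (simp add: abs_mult)
      then have aL: "\<phi> s * \<bar>x s\<bar> = L" using zz \<sigma> L by auto
      have "\<phi> d * \<bar>x s\<bar> \<le> \<phi> s * \<bar>x s\<bar>" using s0 by (intro mult_right_mono) auto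
      then have "\<bar>x s\<bar> \<le> 1 / \<phi> d" using aL L d by (simp add: field_simps)
      then have "(x has_real_derivative f s (x s)) (at s within I)"
        using s dt aL R by (intro x') auto
      then have "(x has_real_derivative f s (x s)) (at s within {d..t})"
        by (rule DERIV_subset [OF _ dt])
      moreover have "(\<phi> has_real_derivative \<phi>' s) (at s within {d..t})"
        using s d by (intro DERIV_subset [OF \<phi>']) auto
      ultimately have "((\<lambda>t. \<sigma> * (\<phi> t * x t) - L) has_real_derivative
          \<sigma> * (\<phi>' s * x s + \<phi> s * f s (x s))) (at s within {d..t})"
        by (auto intro!: derivative_eq_intros simp: algebra_simps)
      moreover have "\<sigma> * (\<phi>' s * x s + \<phi> s * f s (x s)) < 0"
        using upper [of s "x s"] lower [of s "x s"] zz \<sigma> s by auto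
      ultimately show "((\<lambda>t. \<sigma> * (\<phi> t * x t) - L) has_real_derivative
          \<sigma> * (\<phi>' s * x s + \<phi> s * f s (x s))) (at s within {d..t}) \<and>
          \<sigma> * (\<phi>' s * x s + \<phi> s * f s (x s)) < 0" by blast
    qed (use t in auto)
    from this [of 1] this [of "-1"] have "\<bar>\<phi> t * x t\<bar> < L" by auto
    moreover have "0 \<le> \<phi> t" using m [of 0 t] \<phi>0 t d by simp
    ultimately show ?thesis by (simp add: abs_mult)
  qed
  have t0: "0 \<le> t" using t I by auto
  show "\<phi> t * \<bar>x t\<bar> \<le> L"
    using late [OF t] early [OF t] small [of t "x t"] t0 L by (cases "d \<le> t") auto
  show "\<bar>x t\<bar> \<le> R"
  proof (cases "d \<le> t")
    case True
    have "\<phi> d * \<bar>x t\<bar> \<le> \<phi> t * \<bar>x t\<bar>" using m [of d t] True d by (intro mult_right_mono) auto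
    then have "\<bar>x t\<bar> \<le> 1 / \<phi> d" using late [OF t True] L d by (simp add: field_simps)
    then show ?thesis using R by simp
  qed (use early [OF t] R in auto)
qed

section \<open>Saturation and the constants of the closed loop\<close>

lemma funnel_gain_eq:
  assumes "0 \<le> \<phi> t"
  shows "funnel_gain \<phi> t \<xi> = \<phi> t * \<xi> / (1 - \<bar>\<phi> t * \<xi>\<bar>)"
  using assms by (simp add: funnel_gain_def abs_mult)

lemma abs_div_one_minus_abs_le:
  fixes w :: real
  assumes "\<bar>w\<bar> \<le> L" "L < 1"
  shows "\<bar>w / (1 - \<bar>w\<bar>)\<bar> \<le> L / (1 - L)"
proof -
  have "\<bar>w\<bar> / (1 - \<bar>w\<bar>) \<le> L / (1 - L)" using assms by (intro frac_le) auto
  then show ?thesis using assms by (simp add: abs_div)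
qed

text \<open>The gain has a pole on the funnel boundary, whereas Peano's theorem is applied to a
  bounded right-hand side on all states. Clipping \<open>\<phi> t * \<xi>\<close> at
  \<open>L\<close> and \<open>\<xi>\<close> at \<open>R\<close> removes the pole and confines the
  arguments of \<open>G\<close> to a compact set; in the trapping region the clipping is
  inactive.\<close>

lemma saturated_closed_loop:
  fixes G :: "real \<times> real \<times> real \<Rightarrow> real"
  assumes G: "continuous_on UNIV G" and \<phi>: "continuous_on {0..} \<phi>" "\<And>t. 0 \<le> t \<Longrightarrow> 0 \<le> \<phi> t"
    and p: "continuous_on {0..} p" "bounded (p ` {0..})" and L: "0 \<le> L" "L < 1" and R: "0 \<le> R"
  obtains g B where "continuous_on ({0..} \<times> UNIV) (\<lambda>(t, \<xi>). g t \<xi>)"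
    "\<And>t \<xi>. 0 \<le> t \<Longrightarrow> \<bar>g t \<xi>\<bar> \<le> (B :: real)"
    "\<And>t \<xi>. 0 \<le> t \<Longrightarrow> \<phi> t * \<bar>\<xi>\<bar> \<le> L \<Longrightarrow> \<bar>\<xi>\<bar> \<le> R \<Longrightarrow>
      g t \<xi> = G (p t, \<xi>, \<theta> * funnel_gain \<phi> t \<xi>)"
proof -
  define sat :: "real \<Rightarrow> real \<Rightarrow> real" where "sat = (\<lambda>m w. max (- m) (min m w))"
  have sat: "\<bar>sat m w\<bar> \<le> m" if "0 \<le> m" for m w using that by (auto simp: sat_def)
  have sat_id: "sat m w = w" if "\<bar>w\<bar> \<le> m" for m w using that by (auto simp: sat_def)
  define k where "k = (\<lambda>w. sat L w / (1 - \<bar>sat L w\<bar>))"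
  have sL: "1 - \<bar>sat L w\<bar> \<noteq> 0" for w using sat [of L w] L by simp
  have ck: "continuous_on UNIV k"
    unfolding k_def using sL by (auto simp: sat_def intro!: continuous_intros)
  have kb: "\<bar>k w\<bar> \<le> L / (1 - L)" for w
    unfolding k_def using L by (intro abs_div_one_minus_abs_le sat)
  define g where "g = (\<lambda>t \<xi>. G (p t, sat R \<xi>, \<theta> * k (\<phi> t * \<xi>)))"
  obtain P where P: "\<forall>t\<in>{0..}. \<bar>p t\<bar> \<le> P" using p(2) by (auto simp: bounded_iff)
  define U where "U = \<bar>\<theta>\<bar> * (L / (1 - L))"
  have "bounded (G ` ({-P..P} \<times> {-R..R} \<times> {-U..U}))"
    by (intro compact_imp_bounded compact_continuous_image continuous_on_subset [OF G]
        compact_Times) auto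
  then obtain B where B: "\<forall>z \<in> {-P..P} \<times> {-R..R} \<times> {-U..U}. \<bar>G z\<bar> \<le> B"
    by (auto simp: bounded_iff)
  show ?thesis
  proof
    have "continuous_on ({0..} \<times> UNIV) (\<lambda>z. sat R (snd z))"
      unfolding sat_def by (intro continuous_intros)
    moreover have "continuous_on ({0..} \<times> UNIV) (\<lambda>z. p (fst z))"
      by (rule continuous_on_compose2 [OF p(1)]) (auto intro: continuous_intros)
    moreover have "continuous_on ({0..} \<times> UNIV) (\<lambda>z. \<phi> (fst z))"
      by (rule continuous_on_compose2 [OF \<phi>(1)]) (auto intro: continuous_intros)
    ultimately show "continuous_on ({0..} \<times> UNIV) (\<lambda>(t, \<xi>). g t \<xi>)"
      unfolding g_def case_prod_beta
      by (intro continuous_on_compose2 [OF G] continuous_on_compose2 [OF ck] continuous_intros) auto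
    show "\<bar>g t \<xi>\<bar> \<le> B" if "0 \<le> t" for t \<xi>
    proof -
      have "\<bar>\<theta> * k (\<phi> t * \<xi>)\<bar> \<le> U"
        unfolding U_def abs_mult by (intro mult_left_mono kb) simp
      moreover have "\<bar>sat R \<xi>\<bar> \<le> R" by (rule sat [OF R])
      moreover have "\<bar>p t\<bar> \<le> P" using P that by simp
      ultimately show ?thesis unfolding g_def by (intro bspec [OF B]) (simp add: abs_le_iff)
    qed
    show "g t \<xi> = G (p t, \<xi>, \<theta> * funnel_gain \<phi> t \<xi>)"
      if "0 \<le> t" "\<phi> t * \<bar>\<xi>\<bar> \<le> L" "\<bar>\<xi>\<bar> \<le> R" for t \<xi>
    proof -
      have "\<bar>\<phi> t * \<xi>\<bar> \<le> L" using that \<phi>(2) by (simp add: abs_mult)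
      then show ?thesis
        using that \<phi>(2) by (simp add: g_def k_def sat_id funnel_gain_eq)
    qed
  qed
qed

text \<open>The constants are fixed in the order \<open>d\<close>, \<open>R\<close>,
  \<open>M\<close>, \<open>s\<close>, \<open>L\<close>, before any solution is considered. The same
  \<open>L\<close> and \<open>R\<close> thus confine solutions of the original equation and the
  global extensions built from the saturated one.\<close>

lemma closed_loop_trap:
  fixes G :: "real \<times> real \<times> real \<Rightarrow> real" and \<phi> \<phi>' p :: "real \<Rightarrow> real"
  assumes G: "continuous_on UNIV G"
    and dir: "control_direction G (-1)" "control_direction G 1" and \<theta>: "\<theta> \<in> {-1, 1}"
    and bij: "bij_betw \<phi> {0..} {0..}"
    and \<phi>': "\<And>t. 0 \<le> t \<Longrightarrow> (\<phi> has_real_derivative \<phi>' t) (at t within {0..})"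
    and c: "0 < c" "\<And>t. 0 \<le> t \<Longrightarrow> \<phi>' t \<le> c * (1 + \<phi> t)"
    and p: "bounded (p ` {0..})"
  obtains L R where "0 < L" "L < 1" "0 \<le> R"
    "\<And>I x t. \<lbrakk>is_interval I; 0 \<in> I; I \<subseteq> {0..}; continuous_on I x; x 0 = x0;
      \<And>t. \<lbrakk>t \<in> I; \<phi> t * \<bar>x t\<bar> \<le> L; \<bar>x t\<bar> \<le> R\<rbrakk> \<Longrightarrow>
        (x has_real_derivative G (p t, x t, \<theta> * funnel_gain \<phi> t (x t))) (at t within I);
      t \<in> I\<rbrakk> \<Longrightarrow> \<phi> t * \<bar>x t\<bar> \<le> L \<and> \<bar>x t\<bar> \<le> R"
proof -
  have c\<phi>: "continuous_on {0..} \<phi>"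
    using \<phi>' by (auto simp: continuous_on_eq_continuous_within intro: DERIV_continuous)
  note smono = bij_nonneg_strict_mono(1) [OF bij c\<phi>] and \<phi>0 = bij_nonneg_strict_mono(2) [OF bij c\<phi>]
  have mono: "mono_on {0..} \<phi>" using smono by (rule strict_mono_on_imp_mono_on)
  have m: "\<phi> s \<le> \<phi> t" if "0 \<le> s" "s \<le> t" for s t
    using mono that by (auto simp: mono_on_def)
  have pos: "0 \<le> \<phi> t" if "0 \<le> t" for t using m [of 0 t] that \<phi>0 by simp
  obtain P where P: "\<forall>t\<in>{0..}. \<bar>p t\<bar> \<le> P" using p by (auto simp: bounded_iff)
  define r where "r = \<bar>x0\<bar> + 1"
  have r: "1 \<le> r" by (simp add: r_def)
  \<comment> \<open>Inputs in \<open>{-1..1}\<close> cover the initial phase, because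
    \<open>w / (1 - \<bar>w\<bar>)\<close> has modulus at most \<open>1\<close> for
    \<open>\<bar>w\<bar> \<le> 1 / 2\<close>.\<close>
  have "bounded (G ` ({-P..P} \<times> {-r..r} \<times> {-1..1}))"
    by (intro compact_imp_bounded compact_continuous_image continuous_on_subset [OF G]
        compact_Times) auto
  then obtain B where B: "\<forall>z \<in> {-P..P} \<times> {-r..r} \<times> {-1..1}. \<bar>G z\<bar> \<le> B"
    by (auto simp: bounded_iff)
  have P0: "0 \<le> P" using P by fastforce
  have B0: "0 \<le> B" using bspec [OF B, of "(0, 0, 0)"] P0 r by simp
  have "\<exists>e>0. \<forall>t\<in>{0..}. dist t 0 < e \<longrightarrow> dist (\<phi> t) (\<phi> 0) < 1 / (2 * r)"
    using c\<phi>[unfolded continuous_on_iff, rule_format, of 0 "1 / (2 * r)"] r by simp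
  then obtain e where e0: "0 < e" "\<forall>t\<in>{0..}. dist t 0 < e \<longrightarrow> dist (\<phi> t) (\<phi> 0) < 1 / (2 * r)"
    by blast
  have e: "\<phi> t < 1 / (2 * r)" if "0 \<le> t" "t < e" for t
    using bspec [OF e0(2), of t] that \<phi>0 by (simp add: dist_real_def)
  \<comment> \<open>The first entry lies strictly below \<open>e\<close> and yields
    \<open>\<phi> d * r \<le> 1 / 2\<close>; the second yields
    \<open>(B + 1) * d \<le> 1 / 2\<close>.\<close>
  define d where "d = min (e / 2) (1 / (2 * (B + 1)))"
  have d0: "0 < d" "d < e" using e0(1) B0 by (auto simp: d_def min_def)
  have d1: "\<phi> d * r \<le> 1 / 2" using e [of d] d0 r by (simp add: field_simps)
  have d2: "(B + 1) * d \<le> 1 / 2"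
  proof -
    have "(B + 1) * d \<le> (B + 1) * (1 / (2 * (B + 1)))"
      using B0 unfolding d_def by (intro mult_left_mono) auto
    also have "\<dots> = 1 / 2" using B0 by (simp add: field_simps)
    finally show ?thesis .
  qed
  have d3: "0 < \<phi> d" using strict_mono_onD [OF smono, of 0 d] d0 \<phi>0 by simp
  define R where "R = max r (1 / \<phi> d)"
  \<comment> \<open>On the barrier \<open>\<bar>\<xi>\<bar> \<le> 1 / \<phi> t\<close>, so
    \<open>\<phi>' t * \<bar>\<xi>\<bar> / \<phi> t\<close> is at most
    \<open>c * (1 + \<phi> t) / (\<phi> t)\<^sup>2\<close>. This decreases in
    \<open>\<phi> t\<close>, and \<open>M\<close> is its value at \<open>t = d\<close>.\<close>
  define M where "M = c * (1 / (\<phi> d)\<^sup>2 + 1 / \<phi> d)"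
  \<comment> \<open>With \<open>\<eta> = - \<theta>\<close>, the input \<open>\<theta> * s\<close>
    on the upper barrier is \<open>- (\<eta> * s)\<close>, where \<open>G < - M\<close>; on the
    lower barrier the input is \<open>\<eta> * s\<close>, where \<open>G > M\<close>.\<close>
  have "control_direction G (- \<theta>)" using dir \<theta> by auto
  moreover have "compact ({-P..P} \<times> {-R..R})" by (intro compact_Times) auto
  moreover have "{-P..P} \<times> {-R..R} \<noteq> {}" using P0 r by (auto simp: R_def)
  ultimately obtain s where s: "1 < s"
    and up: "\<And>\<rho> \<xi>. (\<rho>, \<xi>) \<in> {-P..P} \<times> {-R..R} \<Longrightarrow> M < G (\<rho>, \<xi>, - \<theta> * s)"
    and down: "\<And>\<rho> \<xi>. (\<rho>, \<xi>) \<in> {-P..P} \<times> {-R..R} \<Longrightarrow> G (\<rho>, \<xi>, - (- \<theta> * s)) < - M"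
    by (rule control_direction_level [OF G, where r = 1 and M = M]) blast
  \<comment> \<open>This solves \<open>L / (1 - L) = s\<close>. Requesting \<open>s > 1\<close>
    places \<open>L\<close> above the level \<open>1 / 2\<close> of the initial phase.\<close>
  define L where "L = s / (1 + s)"
  have L: "1 / 2 < L" "L < 1" "L / (1 - L) = s" using s by (auto simp: L_def field_simps)
  define f where "f = (\<lambda>t \<xi>. G (p t, \<xi>, \<theta> * funnel_gain \<phi> t \<xi>))"
  have fB: "\<bar>f t \<xi>\<bar> \<le> B" if "0 \<le> t" "t \<le> d" "\<bar>\<xi>\<bar> \<le> r" for t \<xi>
  proof -
    have "\<phi> t * \<bar>\<xi>\<bar> \<le> \<phi> d * r"
      using m [of t d] that d3 by (intro mult_mono) auto
    then have "\<bar>\<phi> t * \<xi>\<bar> \<le> 1 / 2" using d1 pos that by (simp add: abs_mult)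
    then have "\<bar>funnel_gain \<phi> t \<xi>\<bar> \<le> 1"
      using abs_div_one_minus_abs_le [of "\<phi> t * \<xi>" "1 / 2"] pos that by (simp add: funnel_gain_eq)
    then have "\<bar>\<theta> * funnel_gain \<phi> t \<xi>\<bar> \<le> 1" using \<theta> by (auto simp: abs_mult)
    moreover have "\<bar>p t\<bar> \<le> P" using P that by simp
    ultimately show ?thesis unfolding f_def using that by (intro bspec [OF B]) (simp add: abs_le_iff)
  qed
  have bnd: "\<bar>\<xi>\<bar> \<le> R" "\<phi>' t * \<bar>\<xi>\<bar> \<le> \<phi> t * M" "0 < \<phi> t"
    if "d \<le> t" "\<bar>\<phi> t * \<xi>\<bar> = L" for t \<xi>
  proof -
    have q: "\<phi> d \<le> \<phi> t" using m [of d t] that d0 by simp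
    then show t0: "0 < \<phi> t" using d3 by simp
    have \<xi>: "\<bar>\<xi>\<bar> \<le> 1 / \<phi> t" using that L t0 by (simp add: field_simps abs_mult)
    also have "\<dots> \<le> 1 / \<phi> d" using q d3 by (simp add: frac_le)
    finally show "\<bar>\<xi>\<bar> \<le> R" by (simp add: R_def)
    have "\<phi>' t * \<bar>\<xi>\<bar> \<le> c * (1 + \<phi> t) * \<bar>\<xi>\<bar>"
      using c(2) [of t] that d0 by (intro mult_right_mono) auto
    also have "\<dots> \<le> c * (1 + \<phi> t) * (1 / \<phi> t)"
      using \<xi> c t0 by (intro mult_left_mono) auto
    also have "\<dots> = \<phi> t * (c * (1 / (\<phi> t)\<^sup>2 + 1 / \<phi> t))"
      using t0 by (simp add: field_simps power2_eq_square)
    also have "\<dots> \<le> \<phi> t * M"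
      unfolding M_def using c t0 q d3
      by (intro mult_left_mono add_mono divide_left_mono power_mono) auto
    finally show "\<phi>' t * \<bar>\<xi>\<bar> \<le> \<phi> t * M" .
  qed
  have inK: "(p t, \<xi>) \<in> {-P..P} \<times> {-R..R}" if "0 \<le> t" "\<bar>\<xi>\<bar> \<le> R" for t \<xi>
    using bspec [OF P, of t] that by auto
  have upper: "\<phi>' t * \<xi> + \<phi> t * f t \<xi> < 0" if t: "d \<le> t" "\<phi> t * \<xi> = L" for t \<xi>
  proof -
    have a: "\<bar>\<phi> t * \<xi>\<bar> = L" using t L by simp
    note b = bnd [OF t(1) a]
    have "0 < \<phi> t * \<xi>" using t L by simp
    then have "0 < \<xi>" using b(3) by (simp add: zero_less_mult_iff)
    have "funnel_gain \<phi> t \<xi> = s"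
      using funnel_gain_eq [of \<phi> t \<xi>] b(3) a t L by simp
    then have "f t \<xi> < - M" using down [OF inK [OF _ b(1)], of t] t d0 by (simp add: f_def)
    then have "\<phi> t * f t \<xi> < \<phi> t * (- M)" using b(3) by (intro mult_strict_left_mono)
    then show ?thesis using b(2) \<open>0 < \<xi>\<close> by simp
  qed
  have lower: "0 < \<phi>' t * \<xi> + \<phi> t * f t \<xi>" if t: "d \<le> t" "\<phi> t * \<xi> = - L" for t \<xi>
  proof -
    have a: "\<bar>\<phi> t * \<xi>\<bar> = L" using t L by simp
    note b = bnd [OF t(1) a]
    have "0 < \<phi> t * (- \<xi>)" using t L by simp
    then have "\<xi> < 0" using b(3) by (simp add: mult_less_0_iff)
    have "funnel_gain \<phi> t \<xi> = - s"
      using funnel_gain_eq [of \<phi> t \<xi>] b(3) a t L by simp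
    then have "M < f t \<xi>" using up [OF inK [OF _ b(1)], of t] t d0 by (simp add: f_def)
    then have "\<phi> t * M < \<phi> t * f t \<xi>" using b(3) by (intro mult_strict_left_mono)
    then show ?thesis using b(2) \<open>\<xi> < 0\<close> by simp
  qed
  show ?thesis
  proof
    show "0 < L" "L < 1" "0 \<le> R" using L r by (auto simp: R_def)
    fix I x t
    assume I: "is_interval I" "0 \<in> I" "I \<subseteq> {0..}" and x: "continuous_on I x" "x 0 = x0"
      and x': "\<And>t. \<lbrakk>t \<in> I; \<phi> t * \<bar>x t\<bar> \<le> L; \<bar>x t\<bar> \<le> R\<rbrakk> \<Longrightarrow>
        (x has_real_derivative G (p t, x t, \<theta> * funnel_gain \<phi> t (x t))) (at t within I)"
      and t: "t \<in> I"
    have rx: "\<bar>x 0\<bar> + 1 = r" by (simp add: x(2) r_def)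
    have fx: "(x has_real_derivative f t (x t)) (at t within I)"
      if "t \<in> I" "\<phi> t * \<bar>x t\<bar> \<le> L" "\<bar>x t\<bar> \<le> R" for t
      unfolding f_def using that by (rule x')
    have \<phi>00: "0 \<le> \<phi> 0" by (simp add: \<phi>0)
    have dx: "\<phi> d * (\<bar>x 0\<bar> + 1) \<le> 1 / 2" unfolding rx by (rule d1)
    have Rx: "\<bar>x 0\<bar> + 1 \<le> R" "1 / \<phi> d \<le> R" unfolding rx by (simp_all add: R_def)
    have fBx: "\<bar>f t \<xi>\<bar> \<le> B" if "0 \<le> t" "t \<le> d" "\<bar>\<xi>\<bar> \<le> \<bar>x 0\<bar> + 1" for t \<xi>
      using that unfolding rx by (rule fB)
    show "\<phi> t * \<bar>x t\<bar> \<le> L \<and> \<bar>x t\<bar> \<le> R"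
      by (intro conjI funnel_trap [where f = f and \<phi> = \<phi>, OF I x(1) fx \<phi>' mono \<phi>00 L(1,2)
            d0(1) d3 dx d2 Rx fBx upper lower t])
  qed
qed

section \<open>The control objective for both polarities\<close>

theorem corollary2p2:
  fixes G :: "real \<times> real \<times> real \<Rightarrow> real"
    and \<phi> \<phi>' :: "real \<Rightarrow> real"
    and c :: real
  assumes "continuous_on UNIV G"
    and "control_direction G (-1)" and "control_direction G 1"
    and "bij_betw \<phi> {0..} {0..}"
    and "\<And>t. 0 \<le> t \<Longrightarrow> (\<phi> has_real_derivative \<phi>' t) (at t within {0..})"
    and "continuous_on {0..} \<phi>'"
    and "0 < c"
    and "\<And>t. 0 \<le> t \<Longrightarrow> \<phi>' t \<le> c * (1 + \<phi> t)"
  shows "\<forall>\<theta>\<in>{-1, 1}. \<forall>x0 :: real. \<forall>p :: real \<Rightarrow> real.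
    continuous_on {0..} p \<and> bounded (p ` {0..}) \<longrightarrow>
    (let u = (\<lambda>t \<xi>. \<theta> * funnel_gain \<phi> t \<xi>);
         sol = ivp_solution (funnel \<phi>) (\<lambda>t \<xi>. G (p t, \<xi>, u t \<xi>)) x0
     in (\<exists>I x. sol I x) \<and>
        (\<forall>I x. sol I x \<longrightarrow> (\<exists>y. sol {0..} y \<and> (\<forall>t\<in>I. y t = x t))) \<and>
        (\<forall>x. sol {0..} x \<longrightarrow>
           (x \<longlongrightarrow> 0) at_top \<and> bounded ((\<lambda>t. u t (x t)) ` {0..})))"
proof (intro ballI allI impI, elim conjE)
  fix \<theta> x0 :: real and p :: "real \<Rightarrow> real"
  assume \<theta>: "\<theta> \<in> {-1, 1}" and p: "continuous_on {0..} p" "bounded (p ` {0..})"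
  have c\<phi>: "continuous_on {0..} \<phi>"
    using assms(5) by (auto simp: continuous_on_eq_continuous_within intro: DERIV_continuous)
  have smono: "\<phi> s < \<phi> t" if "0 \<le> s" "s < t" for s t
    using bij_nonneg_strict_mono(1) [OF assms(4) c\<phi>] that by (auto simp: strict_mono_on_def)
  have \<phi>0: "\<phi> 0 = 0" by (rule bij_nonneg_strict_mono(2) [OF assms(4) c\<phi>])
  have pos: "0 \<le> \<phi> t" if "0 \<le> t" for t using smono [of 0 t] \<phi>0 that by (cases "t = 0") auto
  have lim: "filterlim \<phi> at_top at_top"
    unfolding filterlim_at_top
  proof
    fix Z
    have "\<bar>Z\<bar> \<in> \<phi> ` {0..}" using assms(4) by (simp add: bij_betw_def)
    then obtain t where t: "0 \<le> t" "\<phi> t = \<bar>Z\<bar>" by auto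
    have "Z \<le> \<phi> s" if "t \<le> s" for s
      using smono [of t s] t that by (cases "s = t") auto
    then show "\<forall>\<^sub>F t in at_top. Z \<le> \<phi> t" by (auto simp: eventually_at_top_linorder)
  qed
  define f where "f = (\<lambda>t \<xi>. G (p t, \<xi>, \<theta> * funnel_gain \<phi> t \<xi>))"
  obtain L R where L: "0 < L" "L < 1" and R: "0 \<le> R" and
    trap: "\<And>I x t. \<lbrakk>is_interval I; 0 \<in> I; I \<subseteq> {0..}; continuous_on I x; x 0 = x0;
      \<And>t. \<lbrakk>t \<in> I; \<phi> t * \<bar>x t\<bar> \<le> L; \<bar>x t\<bar> \<le> R\<rbrakk> \<Longrightarrow>
        (x has_real_derivative f t (x t)) (at t within I);
      t \<in> I\<rbrakk> \<Longrightarrow> \<phi> t * \<bar>x t\<bar> \<le> L \<and> \<bar>x t\<bar> \<le> R"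
    unfolding f_def
    using closed_loop_trap [OF assms(1-3) \<theta> assms(4,5,7,8) p(2), where ?x0.0 = x0] by blast
  obtain g B where g: "continuous_on ({0..} \<times> UNIV) (\<lambda>(t, \<xi>). g t \<xi>)"
    and B: "\<And>t \<xi>. 0 \<le> t \<Longrightarrow> norm (g t \<xi>) \<le> (B :: real)"
    and gf: "\<And>t \<xi>. 0 \<le> t \<Longrightarrow> \<phi> t * \<bar>\<xi>\<bar> \<le> L \<Longrightarrow> \<bar>\<xi>\<bar> \<le> R \<Longrightarrow> g t \<xi> = f t \<xi>"
    unfolding f_def
    by (rule saturated_closed_loop [OF assms(1) c\<phi> pos p _ L(2) R, of \<theta>]) (use L in auto)
  define sol where "sol = ivp_solution (funnel \<phi>) f x0"
  have sol_trap: "\<phi> t * \<bar>x t\<bar> \<le> L \<and> \<bar>x t\<bar> \<le> R" if "sol I x" "t \<in> I" for I x t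
    using that by (intro trap [of I x t]) (auto simp: sol_def ivp_solution_def)
  \<comment> \<open>The trap assumes the equation only where \<open>g\<close> and \<open>f\<close>
    agree, so it applies to the global extension \<open>y\<close> before \<open>y\<close> is known
    to solve the original equation. Its conclusion then gives \<open>g = f\<close> along all of
    \<open>y\<close>.\<close>
  have extend: "\<exists>y. sol {0..} y \<and> (\<forall>t\<in>I. y t = x t)"
    if I: "is_interval I" "0 \<in> I" "I \<subseteq> {0..}" and x0: "x 0 = x0"
      and x: "\<And>t. t \<in> I \<Longrightarrow> (x has_real_derivative g t (x t)) (at t within I)" for I x
  proof -
    obtain y where y: "\<And>t. t \<in> I \<Longrightarrow> y t = x t"
      and y': "\<And>t. 0 \<le> t \<Longrightarrow> (y has_real_derivative g t (y t)) (at t within {0..})"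
      using Peano_global_extension [OF g B I, of x] x
      unfolding has_real_derivative_iff_has_vector_derivative by blast
    have cy: "continuous_on {0..} y"
      using y' by (auto simp: continuous_on_eq_continuous_within intro: DERIV_continuous)
    have y0: "y 0 = x0" using y I(2) x0 by simp
    have D: "\<phi> t * \<bar>y t\<bar> \<le> L \<and> \<bar>y t\<bar> \<le> R" if "0 \<le> t" for t
    proof (rule trap [of "{0..}"])
      show "(y has_real_derivative f t (y t)) (at t within {0..})"
        if "t \<in> {0..}" "\<phi> t * \<bar>y t\<bar> \<le> L" "\<bar>y t\<bar> \<le> R" for t
        using y' [of t] gf [of t "y t"] that by simp
    qed (use cy y0 that in \<open>auto simp: is_interval_1\<close>)
    have "(y has_real_derivative f t (y t)) (at t within {0..})" if "0 \<le> t" for t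
      using y' [OF that] gf [OF that, of "y t"] D [OF that] by simp
    moreover have "(t, y t) \<in> funnel \<phi>" if "0 \<le> t" for t
      using D [OF that] L that by (simp add: funnel_def)
    moreover have "{0..} \<noteq> {0::real}" by (metis atLeast_iff singletonD zero_le_one zero_neq_one)
    ultimately have "sol {0..} y"
      unfolding sol_def ivp_solution_def using cy y0 by (auto simp: is_interval_1)
    then show ?thesis using y by blast
  qed
  \<comment> \<open>Existence is extension from the single time \<open>0\<close>, where a derivative
    within \<open>{0}\<close> imposes no condition.\<close>
  have "\<exists>I x. sol I x"
    using extend [of "{0}" "\<lambda>_. x0"] is_interval_cc [of 0 "0 :: real"]
    by (auto simp: has_field_derivative_def has_derivative_within_singleton_iff bounded_linear_mult_right)
  moreover have "\<exists>y. sol {0..} y \<and> (\<forall>t\<in>I. y t = x t)" if "sol I x" for I x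
  proof (rule extend)
    fix t assume t: "t \<in> I"
    \<comment> \<open>Conversely, the trap keeps every original solution in the region where
      saturation is inactive.\<close>
    have "g t (x t) = f t (x t)"
      using sol_trap [OF that t] t that by (intro gf) (auto simp: sol_def ivp_solution_def)
    then show "(x has_real_derivative g t (x t)) (at t within I)"
      using that t by (simp add: sol_def ivp_solution_def)
  qed (use that in \<open>auto simp: sol_def ivp_solution_def\<close>)
  moreover have "(x \<longlongrightarrow> 0) at_top" if "sol {0..} x" for x
  proof (rule Lim_null_comparison)
    \<comment> \<open>\<open>L < 1\<close> turns the trap into this estimate; \<open>t = 0\<close>
      is excluded because \<open>\<phi> 0 = 0\<close>.\<close>
    have "norm (x t) \<le> inverse (\<phi> t)" if t: "0 < t" for t
      using sol_trap [OF \<open>sol {0..} x\<close>, of t] smono [of 0 t] \<phi>0 t L by (simp add: field_simps)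
    then show "\<forall>\<^sub>F t in at_top. norm (x t) \<le> inverse (\<phi> t)"
      by (rule eventually_mono [OF eventually_gt_at_top [of 0]])
    show "((\<lambda>t. inverse (\<phi> t)) \<longlongrightarrow> 0) at_top"
      by (rule tendsto_inverse_0_at_top [OF lim])
  qed
  moreover have "bounded ((\<lambda>t. \<theta> * funnel_gain \<phi> t (x t)) ` {0..})" if "sol {0..} x" for x
    unfolding bounded_iff
  proof (intro exI [of _ "L / (1 - L)"] ballI, elim imageE, hypsubst)
    fix t :: real assume t: "t \<in> {0..}"
    have "\<bar>\<phi> t * x t\<bar> \<le> L" using sol_trap [OF that t] pos t by (simp add: abs_mult)
    then have "\<bar>funnel_gain \<phi> t (x t)\<bar> \<le> L / (1 - L)"
      using abs_div_one_minus_abs_le [OF _ L(2)] pos t by (simp add: funnel_gain_eq)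
    then show "norm (\<theta> * funnel_gain \<phi> t (x t)) \<le> L / (1 - L)"
      using \<theta> by (auto simp: abs_mult)
  qed
  ultimately show "let u = (\<lambda>t \<xi>. \<theta> * funnel_gain \<phi> t \<xi>);
         sol = ivp_solution (funnel \<phi>) (\<lambda>t \<xi>. G (p t, \<xi>, u t \<xi>)) x0
     in (\<exists>I x. sol I x) \<and>
        (\<forall>I x. sol I x \<longrightarrow> (\<exists>y. sol {0..} y \<and> (\<forall>t\<in>I. y t = x t))) \<and>
        (\<forall>x. sol {0..} x \<longrightarrow>
           (x \<longlongrightarrow> 0) at_top \<and> bounded ((\<lambda>t. u t (x t)) ` {0..}))"
    unfolding Let_def sol_def f_def by blast
qed

end
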